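(* Let $R$ be an abelian ring. Then $R$ is VNL if and only if $R$ is an exchange ring such that for every idempotent $e$ of $R$, either $eRe$ or $(1-e)R(1-e)$ is regular.
   Context: Rings are associative with identity. A ring is abelian if all its idempotents are central. An element $a$ of a ring $R$ is (von Neumann) regular if $a=aba$ for some $b\in R$; a ring is regular if all its elements are regular (the zero ring is regular). A ring $R$ is VNL if for each $a\in R$, either $a$ or $1-a$ is regular in $R$. A ring $R$ is an exchange ring if for every $a\in R$ there exists an idempotent $e\in aR$ such that $1-e\in(1-a)R$. *)

theory Defs
  imports "HOL-Algebra.Ring"
begin

text \<open>The locale \<^locale>\<open>ring\<close> of the library is associative with identity, not necessarily
  commutative, and admits the zero ring. The latter matters: for \<open>e = \<zero>\<close> the corner ring below
  is the zero ring.\<close>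

context ring
begin

definition idempotent :: "'a \<Rightarrow> bool"
  where "idempotent e \<longleftrightarrow> e \<in> carrier R \<and> e \<otimes> e = e"

definition vn_regular :: "'a \<Rightarrow> bool"
  where "vn_regular a \<longleftrightarrow> a \<in> carrier R \<and> (\<exists>b \<in> carrier R. a = a \<otimes> b \<otimes> a)"

definition right_ideal_of :: "'a \<Rightarrow> 'a set"
  where "right_ideal_of a = {a \<otimes> r | r. r \<in> carrier R}"

end

locale abelian_ring = ring +
  assumes idempotent_central:
    "\<lbrakk>idempotent e; x \<in> carrier R\<rbrakk> \<Longrightarrow> e \<otimes> x = x \<otimes> e"

locale regular_ring = ring +
  assumes regular: "a \<in> carrier R \<Longrightarrow> vn_regular a"

locale vnl_ring = ring +
  assumes regular_or: "a \<in> carrier R \<Longrightarrow> vn_regular a \<or> vn_regular (\<one> \<ominus> a)"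

locale exchange_ring = ring +
  assumes exchange:
    "a \<in> carrier R \<Longrightarrow>
      \<exists>e. idempotent e \<and> e \<in> right_ideal_of a \<and> \<one> \<ominus> e \<in> right_ideal_of (\<one> \<ominus> a)"

text \<open>The corner ring \<open>eRe\<close>, with the operations and zero of \<open>R\<close> but identity \<open>e\<close>.\<close>

definition corner :: "('a, 'm) ring_scheme \<Rightarrow> 'a \<Rightarrow> ('a, 'm) ring_scheme"
  where "corner R e =
    R\<lparr>carrier := {e \<otimes>\<^bsub>R\<^esub> r \<otimes>\<^bsub>R\<^esub> e | r. r \<in> carrier R}, one := e\<rparr>"

lemma (in ring) ring_corner:
  assumes "idempotent e"
  shows "ring (corner R e)"
proof -
  have e: "e \<in> carrier R" "e \<otimes> e = e"
    using assms by (auto simp: idempotent_def)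
  have mem: "x \<in> carrier (corner R e) \<longleftrightarrow> x \<in> carrier R \<and> e \<otimes> x = x \<and> x \<otimes> e = x" for x
  proof
    assume "x \<in> carrier (corner R e)"
    then obtain r where r: "r \<in> carrier R" "x = e \<otimes> r \<otimes> e"
      by (auto simp: corner_def)
    have "e \<otimes> (e \<otimes> r \<otimes> e) = (e \<otimes> e) \<otimes> r \<otimes> e"
      using r(1) e(1) by (simp add: m_assoc)
    moreover have "(e \<otimes> r \<otimes> e) \<otimes> e = e \<otimes> r \<otimes> (e \<otimes> e)"
      using r(1) e(1) by (simp add: m_assoc)
    ultimately show "x \<in> carrier R \<and> e \<otimes> x = x \<and> x \<otimes> e = x"
      using r e by simp
  next
    assume "x \<in> carrier R \<and> e \<otimes> x = x \<and> x \<otimes> e = x"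
    then have "x = e \<otimes> x \<otimes> e" "x \<in> carrier R"
      by simp_all
    then show "x \<in> carrier (corner R e)"
      by (auto simp: corner_def)
  qed
  have ops [simp]: "mult (corner R e) = mult R" "add (corner R e) = add R"
    "zero (corner R e) = zero R" "one (corner R e) = e"
    by (simp_all add: corner_def)
  show ?thesis
  proof (intro ringI abelian_groupI monoidI)
    fix x y assume x: "x \<in> carrier (corner R e)" and y: "y \<in> carrier (corner R e)"
    show "x \<oplus>\<^bsub>corner R e\<^esub> y \<in> carrier (corner R e)"
      using x y e unfolding mem by (simp add: l_distr r_distr)
    have "e \<otimes> (x \<otimes> y) = x \<otimes> y"
      using x y e unfolding mem by (simp flip: m_assoc)
    then show "x \<otimes>\<^bsub>corner R e\<^esub> y \<in> carrier (corner R e)"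
      using x y e unfolding mem by (simp add: m_assoc)
  next
    fix x assume x: "x \<in> carrier (corner R e)"
    then have "\<ominus> x \<in> carrier (corner R e)"
      using e unfolding mem by (simp add: r_minus l_minus)
    then show "\<exists>y \<in> carrier (corner R e). y \<oplus>\<^bsub>corner R e\<^esub> x = \<zero>\<^bsub>corner R e\<^esub>"
      using x mem by (intro bexI[of _ "\<ominus> x"]) (auto simp: l_neg)
  qed (use e in \<open>auto simp: mem a_ac m_assoc l_distr r_distr\<close>)
qed

end

theory Submission imports Defs begin

text \<open>Idempotents are central, so \<open>R\<close> splits as \<open>eR \<times> (1 - e)R\<close>, and an element is regular iff
  both of its components are. If neither corner is regular, a non-regular \<open>x \<in> eR\<close> and a non-regular
  \<open>y \<in> (1 - e)R\<close> give the element \<open>x + (1 - e) - y\<close>, for which the VNL condition fails. Conversely,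
  if \<open>e \<in> aR\<close> and \<open>1 - e \<in> (1 - a)R\<close>, then \<open>ea\<close> and \<open>(1 - e)(1 - a)\<close> are right invertible in
  their corners, hence regular; whichever corner is regular then makes \<open>1 - a\<close> or \<open>a\<close> regular.\<close>

context ring
begin

lemma one_minus_one_minus:
  assumes "x \<in> carrier R"
  shows "\<one> \<ominus> (\<one> \<ominus> x) = x"
  using assms by (simp add: minus_eq minus_add r_neg2)

lemma one_minus_mult:
  assumes "x \<in> carrier R" "y \<in> carrier R"
  shows "(\<one> \<ominus> x) \<otimes> y = y \<ominus> x \<otimes> y"
  using assms by (simp add: minus_eq l_distr l_minus)

lemma mult_one_minus:
  assumes "x \<in> carrier R" "y \<in> carrier R"
  shows "y \<otimes> (\<one> \<ominus> x) = y \<ominus> y \<otimes> x"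
  using assms by (simp add: minus_eq r_distr r_minus)

lemma idempotent_one_minus:
  assumes "idempotent e"
  shows "idempotent (\<one> \<ominus> e)"
proof -
  have e: "e \<in> carrier R" "e \<otimes> e = e"
    using assms by (auto simp: idempotent_def)
  have "e \<otimes> (\<one> \<ominus> e) = \<zero>"
    using e by (simp add: mult_one_minus) (simp add: minus_eq r_neg)
  then show ?thesis
    using e by (simp add: idempotent_def one_minus_mult) (simp add: minus_eq)
qed

lemma idempotent_mult_cancel:
  assumes "idempotent e" "x \<in> carrier R"
  shows "e \<otimes> (e \<otimes> x) = e \<otimes> x"
  using assms by (simp add: idempotent_def flip: m_assoc)

lemma idempotent_mult_inner_inverse:
  assumes "a \<in> carrier R" "b \<in> carrier R" "a = a \<otimes> b \<otimes> a"
  shows "idempotent (a \<otimes> b)"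
  using assms by (simp add: idempotent_def flip: m_assoc)

end

context abelian_ring
begin

text \<open>As a rewrite rule alongside \<open>m_assoc\<close>, this carries idempotents to the
  front of a product, where \<open>idempotent_mult_cancel\<close> merges repeated ones.\<close>

lemma idempotent_left_commute:
  assumes "idempotent e" "x \<in> carrier R" "y \<in> carrier R"
  shows "x \<otimes> (e \<otimes> y) = e \<otimes> (x \<otimes> y)"
  using assms idempotent_central[of e x] by (simp add: idempotent_def flip: m_assoc)

text \<open>An inner inverse \<open>b\<close> of \<open>x\<close> also serves
  \<open>e \<otimes> x\<close>, because both copies of the central \<open>e\<close> move to the
  front and merge.\<close>

lemma vn_regular_idempotent_mult:
  assumes e: "idempotent e" and x: "vn_regular x"
  shows "vn_regular (e \<otimes> x)"
proof -
  obtain b where b: "x \<in> carrier R" "b \<in> carrier R" "x = x \<otimes> b \<otimes> x"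
    using x by (auto simp: vn_regular_def)
  have ec: "e \<in> carrier R" using e by (simp add: idempotent_def)
  have "e \<otimes> x \<otimes> b \<otimes> (e \<otimes> x) = e \<otimes> (x \<otimes> b \<otimes> x)"
    using e ec b(1,2) by (simp add: m_assoc idempotent_left_commute idempotent_mult_cancel)
  then show ?thesis
    using ec b unfolding vn_regular_def by (metis m_closed)
qed

lemma vn_regular_of_components:
  assumes e: "idempotent e" and x: "x \<in> carrier R"
    and "vn_regular (e \<otimes> x)" "vn_regular ((\<one> \<ominus> e) \<otimes> x)"
  shows "vn_regular x"
proof -
  define f where "f = \<one> \<ominus> e"
  have f: "idempotent f" using e by (simp add: f_def idempotent_one_minus)
  have ec: "e \<in> carrier R" and fc: "f \<in> carrier R"
    using e f by (simp_all add: idempotent_def)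
  have sum: "e \<otimes> x \<oplus> f \<otimes> x = x"
    using ec x by (simp add: f_def one_minus_mult) (simp add: minus_eq a_lcomm r_neg)
  obtain b where b: "b \<in> carrier R" "e \<otimes> x = e \<otimes> x \<otimes> b \<otimes> (e \<otimes> x)"
    using assms by (auto simp: vn_regular_def)
  obtain c where c: "c \<in> carrier R" "f \<otimes> x = f \<otimes> x \<otimes> c \<otimes> (f \<otimes> x)"
    using assms by (auto simp: vn_regular_def f_def)
  \<comment> \<open>The inner inverses of the two components are glued by cutting each down to its
    own corner. Both sides reduce to \<open>e \<otimes> (x \<otimes> (b \<otimes> x)) \<oplus> f
    \<otimes> (x \<otimes> (c \<otimes> x))\<close>.\<close>
  have "x \<otimes> (e \<otimes> b \<oplus> f \<otimes> c) \<otimes> x = e \<otimes> x \<otimes> b \<otimes> (e \<otimes> x) \<oplus> f \<otimes> x \<otimes> c \<otimes> (f \<otimes> x)"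
    using e f ec fc b(1) c(1) x
    by (simp add: m_assoc l_distr r_distr idempotent_left_commute idempotent_mult_cancel)
  then show ?thesis
    using sum b c x ec fc unfolding vn_regular_def by (metis a_closed m_closed)
qed

text \<open>If \<open>e = a \<otimes> r\<close>, then \<open>r\<close> itself is an inner inverse of
  \<open>e \<otimes> a\<close>, since
  \<open>e \<otimes> a \<otimes> r = e \<otimes> e = e\<close>.\<close>

lemma vn_regular_if_in_right_ideal:
  assumes e: "idempotent e" and a: "a \<in> carrier R" and "e \<in> right_ideal_of a"
  shows "vn_regular (e \<otimes> a)"
proof -
  obtain r where r: "r \<in> carrier R" "e = a \<otimes> r"
    using assms by (auto simp: right_ideal_of_def)
  have ec: "e \<in> carrier R" using e by (simp add: idempotent_def)
  have "e \<otimes> a \<otimes> r \<otimes> (e \<otimes> a) = e \<otimes> (a \<otimes> r) \<otimes> (e \<otimes> a)"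
    using ec a r(1) by (simp add: m_assoc)
  also have "\<dots> = e \<otimes> a"
    using e ec a by (simp add: idempotent_mult_cancel m_assoc flip: r(2))
  finally show ?thesis
    using ec a r(1) unfolding vn_regular_def by (metis m_closed)
qed

text \<open>A regular element \<open>a = aba\<close> yields the exchange idempotent \<open>e = ab = ba\<close>: since \<open>ae = a\<close>,
  one has \<open>(1 - a)(1 - e) = 1 - e\<close>.\<close>

lemma exchange_if_vn_regular:
  assumes "vn_regular a"
  shows "\<exists>e. idempotent e \<and> e \<in> right_ideal_of a \<and> \<one> \<ominus> e \<in> right_ideal_of (\<one> \<ominus> a)"
proof -
  obtain b where b: "a \<in> carrier R" "b \<in> carrier R" "a = a \<otimes> b \<otimes> a"
    using assms by (auto simp: vn_regular_def)
  define e where "e = a \<otimes> b"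
  have e: "idempotent e" using idempotent_mult_inner_inverse b by (simp add: e_def)
  have ec: "e \<in> carrier R" using e by (simp add: idempotent_def)
  have "a \<otimes> e = a"
    using idempotent_central[OF e b(1)] b(3) by (simp add: e_def)
  then have "a \<otimes> (\<one> \<ominus> e) = \<zero>"
    using ec b(1) by (simp add: mult_one_minus) (simp add: minus_eq r_neg)
  then have "(\<one> \<ominus> a) \<otimes> (\<one> \<ominus> e) = \<one> \<ominus> e"
    using ec b(1) by (simp add: one_minus_mult) (simp add: minus_eq)
  then have "\<one> \<ominus> e \<in> right_ideal_of (\<one> \<ominus> a)"
    using ec unfolding right_ideal_of_def by (metis (mono_tags, lifting) mem_Collect_eq minus_closed one_closed)
  moreover have "e \<in> right_ideal_of a"
    using b by (auto simp: right_ideal_of_def e_def)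
  ultimately show ?thesis using e by blast
qed

text \<open>Centrality of \<open>e\<close> turns \<open>eRe\<close> into \<open>eR\<close>.
  Regularity of a corner thus becomes a statement about elements of \<open>R\<close>, and later
  arguments need not leave \<open>R\<close>.\<close>

lemma regular_ring_corner_iff:
  assumes e: "idempotent e"
  shows "regular_ring (corner R e) \<longleftrightarrow> (\<forall>x \<in> carrier R. vn_regular (e \<otimes> x))"
proof -
  interpret C: ring "corner R e" using e by (rule ring_corner)
  have ec: "e \<in> carrier R" using e by (simp add: idempotent_def)
  have compress: "e \<otimes> x \<otimes> e = e \<otimes> x" if "x \<in> carrier R" for x
    using that e ec idempotent_central[of e "e \<otimes> x"] by (simp add: idempotent_mult_cancel)
  have carr: "carrier (corner R e) = {e \<otimes> x | x. x \<in> carrier R}"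
    using compress by (auto simp: corner_def) metis+
  have mult: "mult (corner R e) = mult R" by (simp add: corner_def)
  have reg: "C.vn_regular (e \<otimes> x) \<longleftrightarrow> vn_regular (e \<otimes> x)" if x: "x \<in> carrier R" for x
  proof
    assume "C.vn_regular (e \<otimes> x)"
    then show "vn_regular (e \<otimes> x)"
      using ec x by (force simp: C.vn_regular_def vn_regular_def carr mult)
  next
    assume "vn_regular (e \<otimes> x)"
    then obtain b where b: "b \<in> carrier R" "e \<otimes> x = e \<otimes> x \<otimes> b \<otimes> (e \<otimes> x)"
      by (auto simp: vn_regular_def)
    \<comment> \<open>An inner inverse found in \<open>R\<close> may lie outside the corner;
      multiplying it by \<open>e\<close> moves it inside without changing the product.\<close>
    have "e \<otimes> x \<otimes> (e \<otimes> b) \<otimes> (e \<otimes> x) = e \<otimes> x \<otimes> b \<otimes> (e \<otimes> x)"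
      using e ec x b(1) by (simp add: m_assoc idempotent_left_commute idempotent_mult_cancel)
    then have "e \<otimes> x = e \<otimes> x \<otimes> (e \<otimes> b) \<otimes> (e \<otimes> x)"
      using b(2) by simp
    then show "C.vn_regular (e \<otimes> x)"
      unfolding C.vn_regular_def carr mult using x b(1) by blast
  qed
  have "regular_ring (corner R e) \<longleftrightarrow> (\<forall>z \<in> carrier (corner R e). C.vn_regular z)"
    using C.ring_axioms by (auto simp: regular_ring_def regular_ring_axioms_def)
  then show ?thesis
    using reg by (auto simp: carr)
qed

end

theorem theorem3p1:
  fixes R (structure)
  assumes "abelian_ring R"
  shows "vnl_ring R \<longleftrightarrow>
    exchange_ring R \<and>
    (\<forall>e. ring.idempotent R e \<longrightarrow>
      regular_ring (corner R e) \<or> regular_ring (corner R (\<one> \<ominus> e)))"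
proof -
  interpret abelian_ring R by fact
  show ?thesis
  proof (intro iffI conjI allI impI)
    assume "vnl_ring R"
    then interpret vnl_ring R .
    show "exchange_ring R"
    proof
      fix a assume a: "a \<in> carrier R"
      from regular_or[OF a]
      show "\<exists>e. idempotent e \<and> e \<in> right_ideal_of a \<and> \<one> \<ominus> e \<in> right_ideal_of (\<one> \<ominus> a)"
      proof
        \<comment> \<open>The exchange condition is symmetric under replacing \<open>a\<close> and
          \<open>e\<close> by their complements, so the idempotent found for
          \<open>\<one> \<ominus> a\<close> is complemented.\<close>
        assume "vn_regular (\<one> \<ominus> a)"
        then obtain e where "idempotent e" "e \<in> right_ideal_of (\<one> \<ominus> a)" "\<one> \<ominus> e \<in> right_ideal_of a"
          using exchange_if_vn_regular[of "\<one> \<ominus> a"] a by (auto simp: one_minus_one_minus)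
        then show ?thesis
          by (intro exI[of _ "\<one> \<ominus> e"])
            (simp add: idempotent_one_minus one_minus_one_minus idempotent_def[of e])
      qed (rule exchange_if_vn_regular)
    qed
  next
    fix e assume "vnl_ring R" and e: "idempotent e"
    then interpret vnl_ring R by simp
    define f where "f = \<one> \<ominus> e"
    have f: "idempotent f" using e by (simp add: f_def idempotent_one_minus)
    have ec: "e \<in> carrier R" and fc: "f \<in> carrier R"
      using e f by (simp_all add: idempotent_def)
    have ef: "e \<otimes> f = \<zero>"
      using e by (simp add: f_def idempotent_def mult_one_minus) (simp add: minus_eq r_neg)
    then have fe: "f \<otimes> e = \<zero>" using idempotent_central[OF e fc] by simp
    \<comment> \<open>Since \<open>x\<close> and \<open>y\<close> vary independently, this rules out
      a non-regular element in each corner at once.\<close>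
    have "vn_regular (e \<otimes> x) \<or> vn_regular (f \<otimes> y)" if x: "x \<in> carrier R" and y: "y \<in> carrier R" for x y
    proof -
      \<comment> \<open>Chosen so that \<open>a\<close> has \<open>e\<close>-component
        \<open>e \<otimes> x\<close> while \<open>\<one> \<ominus> a\<close> has
        \<open>f\<close>-component \<open>f \<otimes> y\<close>.\<close>
      define a where "a = e \<otimes> x \<oplus> f \<otimes> (\<one> \<ominus> y)"
      have a: "a \<in> carrier R" using ec fc x y by (simp add: a_def)
      have "e \<otimes> (f \<otimes> (\<one> \<ominus> y)) = \<zero>"
        using ec fc y ef by (simp flip: m_assoc)
      then have ea: "e \<otimes> a = e \<otimes> x"
        using e ec fc x y by (simp add: a_def r_distr idempotent_mult_cancel)
      have "f \<otimes> (e \<otimes> x) = \<zero>"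
        using ec fc x fe by (simp flip: m_assoc)
      then have "f \<otimes> a = f \<otimes> (\<one> \<ominus> y)"
        using f ec fc x y by (simp add: a_def r_distr idempotent_mult_cancel)
      then have "f \<otimes> (\<one> \<ominus> a) = f \<otimes> (\<one> \<ominus> (\<one> \<ominus> y))"
        using fc a y by (simp add: mult_one_minus[of _ f])
      then have "f \<otimes> (\<one> \<ominus> a) = f \<otimes> y"
        using y by (simp add: one_minus_one_minus)
      then show ?thesis
        using regular_or[OF a] vn_regular_idempotent_mult e f ea by metis
    qed
    then show "regular_ring (corner R e) \<or> regular_ring (corner R (\<one> \<ominus> e))"
      unfolding f_def[symmetric] regular_ring_corner_iff[OF e] regular_ring_corner_iff[OF f]
      by blast
  next
    assume corners: "exchange_ring R \<and> (\<forall>e. idempotent e \<longrightarrow>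
      regular_ring (corner R e) \<or> regular_ring (corner R (\<one> \<ominus> e)))"
    then interpret exchange_ring R by blast
    show "vnl_ring R"
    proof
      fix a assume a: "a \<in> carrier R"
      obtain e where e: "idempotent e" and ea: "e \<in> right_ideal_of a"
        and fa: "\<one> \<ominus> e \<in> right_ideal_of (\<one> \<ominus> a)"
        using exchange[OF a] by blast
      have f: "idempotent (\<one> \<ominus> e)" using e by (rule idempotent_one_minus)
      from corners e consider "regular_ring (corner R e)" | "regular_ring (corner R (\<one> \<ominus> e))"
        by blast
      then show "vn_regular a \<or> vn_regular (\<one> \<ominus> a)"
      proof cases
        case 1
        \<comment> \<open>The regular corner handles the \<open>e\<close>-component of
          \<open>\<one> \<ominus> a\<close>; membership \<open>fa\<close> handles the complementary
          one.\<close>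
        then have "vn_regular (\<one> \<ominus> a)"
          using a regular_ring_corner_iff[OF e] vn_regular_if_in_right_ideal[OF f _ fa]
          by (auto intro: vn_regular_of_components[OF e, of "\<one> \<ominus> a"])
        then show ?thesis ..
      next
        case 2
        then have "vn_regular a"
          using a regular_ring_corner_iff[OF f] vn_regular_if_in_right_ideal[OF e _ ea]
          by (auto intro: vn_regular_of_components[OF e, of a])
        then show ?thesis ..
      qed
    qed
  qed
qed

end
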